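(* Let $\tilde f : \mathbb{R} \to F(\mathbb{R})$ be a fuzzy-valued function whose $\alpha$-level functions $\tilde f_\alpha^L$ and $\tilde f_\alpha^U$ are, for all $\alpha \in [0,1]$, three times continuously differentiable on $\mathbb{R}$. Let $F(x) = \int_0^1 \{\tilde f_\alpha^L(x) + \tilde f_\alpha^U(x)\}\, d\alpha$, and let $x^* \in \mathbb{R}$ be a point such that (1) $F'(x^* ) = 0$ and (2) $F''(x^* ) \neq 0$. Then for all $x^{(0)}$ sufficiently close to $x^*$, the Newton iteration $$x^{(k+1)} = x^{(k)} - \frac{F'(x^{(k)})}{F''(x^{(k)})}, \qquad k = 0,1,2,\dots,$$ is well-defined for all $k$ (that is, $F''(x^{(k)}) \neq 0$ for every $k$), and the sequence $(x^{(k)})$ converges to $x^*$ with order of convergence at least $2$.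
   Context: A fuzzy number is a function $\tilde a : \mathbb{R} \to [0,1]$ such that: (i) there is $x_0 \in \mathbb{R}$ with $\tilde a(x_0) = 1$; (ii) $\tilde a(tx + (1-t)y) \ge \min\{\tilde a(x), \tilde a(y)\}$ for all $x,y \in \mathbb{R}$, $t \in [0,1]$; (iii) $\tilde a$ is upper semicontinuous, i.e. $\{x : \tilde a(x) \ge \alpha\}$ is closed for each $\alpha \in (0,1]$; (iv) the closure of $\{x \in \mathbb{R} : \tilde a(x) > 0\}$ is compact. $F(\mathbb{R})$ denotes the set of all fuzzy numbers (not to be confused with the real-valued function $F$ of the claim). For $\alpha \in (0,1]$ the $\alpha$-level set of $\tilde a$ is $\tilde a_\alpha = \{x \in \mathbb{R} : \tilde a(x) \ge \alpha\}$, and $\tilde a_0$ is the closure of $\{x \in \mathbb{R} : \tilde a(x) > 0\}$. Each $\tilde a_\alpha$ is a nonempty compact interval, written $\tilde a_\alpha = [\tilde a_\alpha^L, \tilde a_\alpha^U]$. A fuzzy-valued function on $\mathbb{R}$ is a map $\tilde f : \mathbb{R} \to F(\mathbb{R})$; its $\alpha$-level functions are the real-valued functions $\tilde f_\alpha^L(x) = (\tilde f(x))_\alpha^L$ and $\tilde f_\alpha^U(x) = (\tilde f(x))_\alpha^U$, for $\alpha \in [0,1]$. Convention: the derivatives of $F$ are given by differentiation under the integral sign, $$F'(x) = \int_0^1 \left\{ (\tilde f_\alpha^L)'(x) + (\tilde f_\alpha^U)'(x) \right\} d\alpha, \qquad F''(x) = \int_0^1 \left\{ (\tilde f_\alpha^L)''(x)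 + (\tilde f_\alpha^U)''(x) \right\} d\alpha,$$ where the primes on $\tilde f_\alpha^L$, $\tilde f_\alpha^U$ denote derivatives with respect to $x$.
   Formalization: Adds the assumption that F'' is differentiable at x*; smoothness of each level function alone does not give it, and without it the order of convergence can be only 3/2 (e.g. F behaving like |x|^{5/2} plus a smooth even function near x* = 0). *)

theory Defs
  imports "HOL-Analysis.Analysis"
begin

definition fuzzy_numbers :: "(real \<Rightarrow> real) set" where
  "fuzzy_numbers = {a.
     (\<forall>x. 0 \<le> a x \<and> a x \<le> 1) \<and>
     (\<exists>x0. a x0 = 1) \<and>
     (\<forall>x y t. 0 \<le> t \<and> t \<le> 1 \<longrightarrow> a (t * x + (1 - t) * y) \<ge> min (a x) (a y)) \<and>
     (\<forall>\<alpha>. 0 < \<alpha> \<and> \<alpha> \<le> 1 \<longrightarrow> closed {x. a x \<ge> \<alpha>}) \<and>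
     compact (closure {x. a x > 0})}"

definition level :: "(real \<Rightarrow> real) \<Rightarrow> real \<Rightarrow> real set" where
  "level a \<alpha> = (if \<alpha> = 0 then closure {x. a x > 0} else {x. a x \<ge> \<alpha>})"

text \<open>For a fuzzy number the level sets are compact intervals, so \<open>Inf\<close> and \<open>Sup\<close> are their
  end points; see \<open>level_eq_interval\<close> below.\<close>

definition lower_end :: "(real \<Rightarrow> real) \<Rightarrow> real \<Rightarrow> real" where
  "lower_end a \<alpha> = Inf (level a \<alpha>)"

definition upper_end :: "(real \<Rightarrow> real) \<Rightarrow> real \<Rightarrow> real" where
  "upper_end a \<alpha> = Sup (level a \<alpha>)"

lemma level_eq_interval:
  assumes a: "a \<in> fuzzy_numbers" and \<alpha>: "0 \<le> \<alpha>" "\<alpha> \<le> 1"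
  shows "level a \<alpha> \<noteq> {}" and "level a \<alpha> = {lower_end a \<alpha>..upper_end a \<alpha>}"
proof -
  have conv: "\<And>x y t. 0 \<le> t \<Longrightarrow> t \<le> 1 \<Longrightarrow> min (a x) (a y) \<le> a (t * x + (1 - t) * y)"
    and cl: "\<And>\<beta>. 0 < \<beta> \<Longrightarrow> \<beta> \<le> 1 \<Longrightarrow> closed {x. \<beta> \<le> a x}"
    and K: "compact (closure {x. 0 < a x})"
    using a by (auto simp: fuzzy_numbers_def)
  obtain x0 where x0: "a x0 = 1"
    using a by (auto simp: fuzzy_numbers_def)
  have mid: "min (a x) (a y) \<le> a z" if "x \<le> z" "z \<le> y" for x y z
  proof (cases "x = y")
    case False
    define t where "t = (y - z) / (y - x)"
    have "0 \<le> t" "t \<le> 1" using that False by (auto simp: t_def field_simps)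
    moreover have "t * x + (1 - t) * y = y - t * (y - x)" by (simp add: algebra_simps)
    then have "t * x + (1 - t) * y = z" using False by (simp add: t_def)
    ultimately show ?thesis using conv[of t x y] by simp
  qed (use that in auto)
  have ivl: "is_interval {x. \<beta> \<le> a x}" "is_interval {x. \<beta> < a x}" for \<beta>
    unfolding is_interval_1 using mid by (smt (verit) mem_Collect_eq)+
  have sub: "\<alpha> \<noteq> 0 \<Longrightarrow> {x. \<alpha> \<le> a x} \<subseteq> closure {x. 0 < a x}"
    using \<alpha> closure_subset[of "{x. 0 < a x}"] by fastforce
  have ne: "level a \<alpha> \<noteq> {}"
  proof -
    have "x0 \<in> level a \<alpha>"
      using \<alpha> x0 closure_subset[of "{x. 0 < a x}"] by (auto simp: level_def)
    then show ?thesis by blast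
  qed
  have comp: "compact (level a \<alpha>)"
  proof (cases "\<alpha> = 0")
    case False
    then have "closed {x. \<alpha> \<le> a x}" using cl \<alpha> by simp
    then have "compact (closure {x. 0 < a x} \<inter> {x. \<alpha> \<le> a x})"
      using K compact_Int_closed by blast
    then show ?thesis using False sub by (simp add: level_def Int_absorb1)
  qed (use K in \<open>simp add: level_def\<close>)
  have "connected (level a \<alpha>)"
    using ivl[of \<alpha>] ivl[of 0]
    by (auto simp: level_def is_interval_connected_1 intro: connected_imp_connected_closure)
  with comp obtain l u where lu: "level a \<alpha> = {l..u}"
    using connected_compact_interval_1 by (metis box_real(2))
  with ne have "l \<le> u" by auto
  then show "level a \<alpha> = {lower_end a \<alpha>..upper_end a \<alpha>}"
    using lu by (simp add: lower_end_def upper_end_def)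
  show "level a \<alpha> \<noteq> {}" by (fact ne)
qed

definition C_diff :: "nat \<Rightarrow> (real \<Rightarrow> real) \<Rightarrow> bool" where
  "C_diff n g \<longleftrightarrow>
     (\<forall>j<n. \<forall>x. (deriv ^^ j) g differentiable (at x)) \<and>
     continuous_on UNIV ((deriv ^^ n) g)"

text \<open>\<open>level_integrand f j x \<alpha>\<close> is the sum of the \<open>j\<close>-th derivatives, with respect to \<open>x\<close>, of the
  two \<open>\<alpha>\<close>-level functions of \<open>f\<close>. Its integral over \<open>\<alpha>\<close> is \<open>F\<close> for \<open>j = 0\<close>, and for
  \<open>j = 1, 2\<close> it is \<open>F'\<close> and \<open>F''\<close> as obtained by differentiation under the integral sign.\<close>

definition level_integrand :: "(real \<Rightarrow> real \<Rightarrow> real) \<Rightarrow> nat \<Rightarrow> real \<Rightarrow> real \<Rightarrow> real" where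
  "level_integrand f j x \<alpha> =
     (deriv ^^ j) (\<lambda>y. lower_end (f y) \<alpha>) x + (deriv ^^ j) (\<lambda>y. upper_end (f y) \<alpha>) x"

definition level_integral :: "(real \<Rightarrow> real \<Rightarrow> real) \<Rightarrow> nat \<Rightarrow> real \<Rightarrow> real" where
  "level_integral f j x = integral {0..1} (level_integrand f j x)"

definition converges_with_order_at_least :: "real \<Rightarrow> (nat \<Rightarrow> real) \<Rightarrow> real \<Rightarrow> bool" where
  "converges_with_order_at_least p X L \<longleftrightarrow>
     X \<longlonglongrightarrow> L \<and> (\<exists>C. \<forall>k. \<bar>X (Suc k) - L\<bar> \<le> C * \<bar>X k - L\<bar> powr p)"

end

theory Submission
  imports Defs
begin

text \<open>
  Since \<open>F''\<close> has a derivative at \<open>x*\<close>, it satisfies \<open>|F''(y) - F''(x*)| \<le> M |y - x*|\<close> near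
  \<open>x*\<close>. By the mean value theorem \<open>F'(y) = F''(\<xi>) (y - x*)\<close> with \<open>\<xi>\<close> between \<open>y\<close> and \<open>x*\<close>,
  so the error after one Newton step is \<open>(y - x*) (F''(y) - F''(\<xi>)) / F''(y)\<close>, which is at most
  \<open>(4 M / |F''(x*)|) |y - x*|\<^sup>2\<close> wherever \<open>|F''(y)| \<ge> |F''(x*)| / 2\<close>. Close to \<open>x*\<close> this at least
  halves the error.
\<close>

text \<open>Near \<open>z\<close> the difference quotient stays within 1 of the derivative
  \<open>D\<close>, so \<open>\<bar>D\<bar> + 1\<close> serves as the constant. One of the two
  points compared is always \<open>z\<close>; nothing is claimed for two arbitrary nearby
  points.\<close>

lemma differentiable_imp_lipschitz_at:
  fixes f :: "real \<Rightarrow> real"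
  assumes "f differentiable (at z)"
  obtains M d where "M > 0" "d > 0" "\<And>y. \<bar>y - z\<bar> < d \<Longrightarrow> \<bar>f y - f z\<bar> \<le> M * \<bar>y - z\<bar>"
proof -
  obtain D where "(f has_real_derivative D) (at z)"
    using assms real_differentiable_def by blast
  then have "((\<lambda>y. (f y - f z) / (y - z)) \<longlongrightarrow> D) (at z)"
    by (simp add: has_field_derivative_iff)
  then have "eventually (\<lambda>y. dist ((f y - f z) / (y - z)) D < 1) (at z)"
    by (rule tendstoD) simp
  then obtain d where d: "d > 0"
    and near: "\<And>y. y \<noteq> z \<Longrightarrow> dist y z < d \<Longrightarrow> dist ((f y - f z) / (y - z)) D < 1"
    by (auto simp: eventually_at)
  have "\<bar>f y - f z\<bar> \<le> (\<bar>D\<bar> + 1) * \<bar>y - z\<bar>" if "\<bar>y - z\<bar> < d" for y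
  proof (cases "y = z")
    case False
    then have "\<bar>(f y - f z) / (y - z)\<bar> \<le> \<bar>D\<bar> + 1"
      using near[of y] that unfolding dist_real_def by linarith
    then show ?thesis
      using False by (simp add: abs_divide divide_le_eq)
  qed simp
  with d show ?thesis
    by (intro that[of "\<bar>D\<bar> + 1" d]) auto
qed

lemma newton_step_quadratic:
  fixes g h :: "real \<Rightarrow> real"
  assumes deriv: "\<And>y. (g has_real_derivative h y) (at y)"
    and diff: "h differentiable (at z)"
    and root: "g z = 0" and simple: "h z \<noteq> 0"
  obtains C d where "C > 0" "d > 0"
    "\<And>y. \<bar>y - z\<bar> < d \<Longrightarrow> h y \<noteq> 0"
    "\<And>y. \<bar>y - z\<bar> < d \<Longrightarrow> \<bar>y - g y / h y - z\<bar> \<le> C * \<bar>y - z\<bar>\<^sup>2"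
proof -
  obtain M e where M: "M > 0" and e: "e > 0"
    and lip: "\<And>y. \<bar>y - z\<bar> < e \<Longrightarrow> \<bar>h y - h z\<bar> \<le> M * \<bar>y - z\<bar>"
    using differentiable_imp_lipschitz_at[OF diff] by blast
  \<comment> \<open>One factor 2 comes from comparing \<open>h y\<close> with \<open>h \<xi>\<close>
    by way of \<open>h z\<close>, the other from the lower bound \<open>\<bar>h z\<bar> / 2\<close>
    for the denominator.\<close>
  define C where "C = 4 * M / \<bar>h z\<bar>"
  \<comment> \<open>Below \<open>e\<close> the Lipschitz estimate is available; the second bound
    keeps \<open>M * \<bar>y - z\<bar>\<close> under \<open>\<bar>h z\<bar> / 2\<close>, so that
    \<open>h\<close> cannot reach 0.\<close>
  define d where "d = min e (\<bar>h z\<bar> / (2 * M))"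
  have lower: "\<bar>h z\<bar> / 2 \<le> \<bar>h y\<bar>" if "\<bar>y - z\<bar> < d" for y
  proof -
    have "M * \<bar>y - z\<bar> \<le> \<bar>h z\<bar> / 2"
      using that M by (simp add: d_def field_simps)
    with lip[of y] that show ?thesis by (simp add: d_def)
  qed
  have step: "\<bar>y - g y / h y - z\<bar> \<le> C * \<bar>y - z\<bar>\<^sup>2" if y: "\<bar>y - z\<bar> < d" for y
  proof -
    \<comment> \<open>The mean value theorem needs two distinct points. For \<open>y = z\<close>
      both sides vanish by \<open>root\<close>, and \<open>z\<close> itself can be taken for
      \<open>\<xi>\<close>.\<close>
    obtain \<xi> where \<xi>: "\<bar>\<xi> - z\<bar> \<le> \<bar>y - z\<bar>" and g: "g y = h \<xi> * (y - z)"
    proof (cases y z rule: linorder_cases)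
      case less
      then obtain \<xi> where "y < \<xi>" "\<xi> < z" "g z - g y = (z - y) * h \<xi>"
        using MVT2[of y z g h] deriv by blast
      then show ?thesis using root by (intro that[of \<xi>]) (auto simp: algebra_simps)
    next
      case greater
      then obtain \<xi> where "z < \<xi>" "\<xi> < y" "g y - g z = (y - z) * h \<xi>"
        using MVT2[of z y g h] deriv by blast
      then show ?thesis using root by (intro that[of \<xi>]) (auto simp: algebra_simps)
    qed (use root that in auto)
    have hy: "\<bar>h y\<bar> > 0" using lower[OF y] simple by linarith
    \<comment> \<open>As \<open>lip\<close> is anchored at \<open>z\<close>, it is applied to
      \<open>y\<close> and to \<open>\<xi>\<close> separately; \<open>\<xi>\<close> is no farther
      from \<open>z\<close> than \<open>y\<close> is.\<close>
    have "M * \<bar>\<xi> - z\<bar> \<le> M * \<bar>y - z\<bar>" using \<xi> M by simp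
    moreover have "\<bar>y - z\<bar> < e" using y by (simp add: d_def)
    ultimately have "\<bar>h y - h \<xi>\<bar> \<le> 2 * M * \<bar>y - z\<bar>"
      using lip[of y] lip[of \<xi>] \<xi> by linarith
    then have num: "\<bar>y - z\<bar> * \<bar>h y - h \<xi>\<bar> \<le> 2 * M * \<bar>y - z\<bar>\<^sup>2"
      using mult_left_mono[of "\<bar>h y - h \<xi>\<bar>" "2 * M * \<bar>y - z\<bar>" "\<bar>y - z\<bar>"]
      by (simp add: power2_eq_square mult_ac)
    have "y - g y / h y - z = (y - z) * (h y - h \<xi>) / h y"
      using hy g by (simp add: field_simps)
    then have "\<bar>y - g y / h y - z\<bar> = \<bar>y - z\<bar> * \<bar>h y - h \<xi>\<bar> / \<bar>h y\<bar>"
      by (simp add: abs_mult)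
    also have "\<dots> \<le> 2 * M * \<bar>y - z\<bar>\<^sup>2 / (\<bar>h z\<bar> / 2)"
      using num lower[OF y] simple M by (intro frac_le) auto
    also have "\<dots> = C * \<bar>y - z\<bar>\<^sup>2" by (simp add: C_def)
    finally show ?thesis .
  qed
  show ?thesis
  proof (rule that[of C d])
    show "C > 0" "d > 0" using M e simple by (auto simp: C_def d_def)
    show "h y \<noteq> 0" if "\<bar>y - z\<bar> < d" for y
      using lower[OF that] simple by linarith
  qed (rule step)
qed

text \<open>Inside the ball one factor \<open>C * \<bar>y - z\<bar>\<close> of the quadratic bound
  is at most 1/2. Each step therefore halves the error, which traps the iterates and gives a
  geometric majorant.\<close>

lemma quadratic_contraction_converges:
  fixes x :: "nat \<Rightarrow> real" and T :: "real \<Rightarrow> real"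
  assumes C: "C > 0" and Cr: "C * r \<le> 1 / 2"
    and step: "\<And>y. \<bar>y - z\<bar> < r \<Longrightarrow> \<bar>T y - z\<bar> \<le> C * \<bar>y - z\<bar>\<^sup>2"
    and start: "\<bar>x 0 - z\<bar> < r" and iter: "\<And>k. x (Suc k) = T (x k)"
  shows "\<bar>x k - z\<bar> < r" and "converges_with_order_at_least 2 x z"
proof -
  \<comment> \<open>Both bounds go through one induction: \<open>step\<close> applies to
    \<open>x k\<close> only while \<open>x k\<close> lies within \<open>r\<close> of
    \<open>z\<close>.\<close>
  have bound: "\<bar>x k - z\<bar> < r \<and> \<bar>x k - z\<bar> \<le> \<bar>x 0 - z\<bar> * (1 / 2) ^ k" for k
  proof (induction k)
    case (Suc k)
    have "C * \<bar>x k - z\<bar> \<le> C * r" using Suc C by simp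
    then have "C * \<bar>x k - z\<bar> * \<bar>x k - z\<bar> \<le> 1 / 2 * \<bar>x k - z\<bar>"
      using Cr by (intro mult_right_mono) auto
    moreover have "C * \<bar>x k - z\<bar>\<^sup>2 = C * \<bar>x k - z\<bar> * \<bar>x k - z\<bar>"
      unfolding power2_eq_square by (rule mult.assoc[symmetric])
    ultimately have "\<bar>x (Suc k) - z\<bar> \<le> \<bar>x k - z\<bar> / 2"
      using step[of "x k"] Suc iter[of k] by linarith
    moreover have "\<bar>x k - z\<bar> / 2 < r"
      using Suc.IH abs_ge_zero[of "x k - z"] by (simp del: abs_ge_zero)
    ultimately show ?case using Suc by simp
  qed (use start in simp)
  then show "\<bar>x k - z\<bar> < r" by blast
  have "(\<lambda>k. \<bar>x 0 - z\<bar> * (1 / 2) ^ k) \<longlonglongrightarrow> 0"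
    by (intro tendsto_mult_right_zero LIMSEQ_realpow_zero) auto
  then have "(\<lambda>k. x k - z) \<longlonglongrightarrow> 0"
    by (rule Lim_null_comparison[rotated]) (simp add: bound)
  moreover have "\<bar>x (Suc k) - z\<bar> \<le> C * \<bar>x k - z\<bar> powr 2" for k
    using step[of "x k"] bound[of k] iter[of k] by simp
  ultimately show "converges_with_order_at_least 2 x z"
    unfolding converges_with_order_at_least_def using LIM_zero_iff by blast
qed

theorem theorem3p3:
  fixes f :: "real \<Rightarrow> real \<Rightarrow> real"
    and F F' F'' :: "real \<Rightarrow> real"
    and xstar :: real
  assumes fuzzy: "\<And>x. f x \<in> fuzzy_numbers"
    and lower_C3: "\<And>\<alpha>. 0 \<le> \<alpha> \<Longrightarrow> \<alpha> \<le> 1 \<Longrightarrow> C_diff 3 (\<lambda>x. lower_end (f x) \<alpha>)"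
    and upper_C3: "\<And>\<alpha>. 0 \<le> \<alpha> \<Longrightarrow> \<alpha> \<le> 1 \<Longrightarrow> C_diff 3 (\<lambda>x. upper_end (f x) \<alpha>)"
    and F: "F = level_integral f 0"
    and F': "F' = level_integral f 1"
    and F'': "F'' = level_integral f 2"
    and integrable: "\<And>j x. j \<in> {1, 2} \<Longrightarrow> level_integrand f j x integrable_on {0..1}"
    and deriv_F: "\<And>x. (F has_real_derivative F' x) (at x)"
    and deriv_F': "\<And>x. (F' has_real_derivative F'' x) (at x)"
    and F''_diff: "F'' differentiable (at xstar)"
    and critical: "F' xstar = 0"
    and nondegenerate: "F'' xstar \<noteq> 0"
  shows "\<exists>\<delta>>0. \<forall>x :: nat \<Rightarrow> real.
           \<bar>x 0 - xstar\<bar> < \<delta> \<and> (\<forall>k. x (Suc k) = x k - F' (x k) / F'' (x k)) \<longrightarrow>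
             (\<forall>k. F'' (x k) \<noteq> 0) \<and> converges_with_order_at_least 2 x xstar"
proof -
  obtain C d where C: "C > 0" and d: "d > 0"
    and nz: "\<And>y. \<bar>y - xstar\<bar> < d \<Longrightarrow> F'' y \<noteq> 0"
    and step: "\<And>y. \<bar>y - xstar\<bar> < d \<Longrightarrow> \<bar>y - F' y / F'' y - xstar\<bar> \<le> C * \<bar>y - xstar\<bar>\<^sup>2"
    using newton_step_quadratic[OF deriv_F' F''_diff critical nondegenerate] by blast
  \<comment> \<open>The bound \<open>d\<close> makes the one-step estimate valid, and
    \<open>1 / (2 * C)\<close> makes it a contraction by 1/2.\<close>
  define \<delta> where "\<delta> = min d (1 / (2 * C))"
  have "\<delta> > 0" using C d by (simp add: \<delta>_def)
  have "C * \<delta> \<le> C * (1 / (2 * C))" using C unfolding \<delta>_def by (intro mult_left_mono) auto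
  then have C\<delta>: "C * \<delta> \<le> 1 / 2" using C by simp
  have "(\<forall>k. F'' (x k) \<noteq> 0) \<and> converges_with_order_at_least 2 x xstar"
    if "\<bar>x 0 - xstar\<bar> < \<delta>" and "\<forall>k. x (Suc k) = x k - F' (x k) / F'' (x k)"
    for x :: "nat \<Rightarrow> real"
  proof -
    have "\<bar>y - F' y / F'' y - xstar\<bar> \<le> C * \<bar>y - xstar\<bar>\<^sup>2" if "\<bar>y - xstar\<bar> < \<delta>" for y
      using step[of y] that by (simp add: \<delta>_def)
    note conv = quadratic_contraction_converges
      [OF C C\<delta> this that(1) that(2)[rule_format]]
    \<comment> \<open>Since division by 0 yields 0 in HOL, the recursion alone does not force a
      nonzero denominator; it follows from the iterates staying within
      \<open>\<delta> \<le> d\<close>.\<close>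
    have "F'' (x k) \<noteq> 0" for k
      using nz[of "x k"] conv(1)[of k] by (simp add: \<delta>_def)
    with conv(2) show ?thesis by blast
  qed
  with \<open>\<delta> > 0\<close> show ?thesis by blast
qed

end
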